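(* Let $A\in\mathbb{R}^{m\times n}$ and let $C\subseteq\mathbb{R}^n$, $D\subseteq\mathbb{R}^m$ be nonempty closed sets (possibly nonconvex) with $C^\infty\cap A^{-1}D^\infty=\{0\}$. Suppose that the function $F(x)=\frac12 d^2(Ax,D)+\delta_C(x)$ is a KL function. Let $\{x^t\}$ be a sequence generated by the algorithm $\mathsf{SpFeas}_{\mathrm{DC}_{\mathsf{ls}}}$ described in the context with $M=0$. Then the sequence $\{x^t\}$ is bounded. Let $x^*$ be an accumulation point of $\{x^t\}$ and suppose that the function $y\mapsto\frac12 d^2(y,D)$ is continuously differentiable at $Ax^*$ with locally Lipschitz gradient. Then the whole sequence $\{x^t\}$ is convergent.
   Context: Notation. $\|\cdot\|$ is the Euclidean norm. For a nonempty closed set $S$: $d(x,S)=\inf_{u\in S}\|x-u\|$; $\mathrm{Proj}_S(x)=\mathrm{Argmin}_{y\in S}\|y-x\|$ (a nonempty set, not necessarily a singleton); the horizon cone is $S^\infty=\{x:\ \exists\, x^t\in S,\ \beta_t\downarrow 0 \text{ with } \beta_t x^t\to x\}$; $A^{-1}D^\infty=\{x\in\mathbb{R}^n: Ax\in D^\infty\}$; $\delta_C$ is the indicator function ($0$ on $C$, $+\infty$ elsewhere). "Continuously differentiable at $\bar y$ with locally Lipschitz gradient" means that the function is continuously differentiable on a neighborhood of $\bar y$ and its gradient is Lipschitz continuous on a neighborhood of $\bar y$. For a proper lower semicontinuous $f:\mathbb{R}^n\to(-\infty,\infty]$ and $\bar x\in\mathrm{dom} f$, the regular subdifferential is $\hat\partial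 f(\bar x)=\{v:\liminf_{x\to\bar x,x\ne\bar x}\frac{f(x)-f(\bar x)-\langle v,x-\bar x\rangle}{\|x-\bar x\|}\ge 0\}$ and the (limiting) subdifferential is $\partial f(\bar x)=\{v:\exists\, x^t\to\bar x \text{ with } f(x^t)\to f(\bar x),\ v^t\to v,\ v^t\in\hat\partial f(x^t)\ \forall t\}$; both are empty outside $\mathrm{dom} f$; $\mathrm{dom}\,\partial f=\{x:\partial f(x)\neq\emptyset\}$. KL property. A proper closed (i.e. lower semicontinuous) function $f$ satisfies the KL property at $\bar x\in\mathrm{dom}\,\partial f$ if there exist a neighborhood $U$ of $\bar x$, $s\in(0,\infty]$ and a continuous concave function $\psi:[0,s)\to\mathbb{R}_+$ with $\psi(0)=0$ such that (i) $\psi$ is continuously differentiable on $(0,s)$ with $\psi'>0$; (ii) for all $x\in U$ with $f(\bar x)<f(x)<f(\bar x)+s$, one has $\psi'(f(x)-f(\bar x))\,d(0,\partial f(x))\ge 1$ (with $d(0,\emptyset)=+\infty$). $f$ is a KL function if it satisfies the KL property at all points of $\mathrm{dom}\,\partial f$. Algorithm $\mathsf{SpFeas}_{\mathrm{DC}_{\mathsf{ls}}}$ (run without termination, so that it generates an infinite sequence). Step 0. Choose $x^0\in C$, $L_{\max}\ge L_{\min}>0$, $\tau>1$, $c>0$ and an integer $M\ge 0$. Set $t=0$. Step 1. Choose any $L_t^0\in[L_{\min},L_{\max}]$ and set $L_t=L_t^0$. 1a) Pick any $\eta^t\in\mathrm{Proj}_D(Ax^t)$ and find $u\in\mathrm{Proj}_C\left(x^t-\frac{A^T(Ax^t-\eta^t)}{L_t}\right)$.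 1b) If $d^2(Au,D)\le\max_{[t-M]_+\le i\le t}d^2(Ax^i,D)-c\|u-x^t\|^2$, where $[a]_+=\max\{a,0\}$, go to Step 2. 1c) Set $L_t\leftarrow\tau L_t$ and go to Step 1a). Step 2. Set $\bar L_t=L_t$, $x^{t+1}=u$, $t\leftarrow t+1$ and go to Step 1. *)

theory Defs
  imports "HOL-Analysis.Analysis"
begin

section \<open>Projections and horizon cones\<close>

definition Proj :: "'a::euclidean_space set \<Rightarrow> 'a \<Rightarrow> 'a set" where
  "Proj S x = {y. is_arg_min (\<lambda>y. norm (y - x)) (\<lambda>y. y \<in> S) y}"

definition horizon_cone :: "'a::euclidean_space set \<Rightarrow> 'a set" where
  "horizon_cone S = {x. \<exists>X \<beta>. (\<forall>t::nat. X t \<in> S) \<and> (\<forall>t. \<beta> t > 0) \<and> decseq \<beta> \<and>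
     \<beta> \<longlonglongrightarrow> 0 \<and> (\<lambda>t. \<beta> t *\<^sub>R X t) \<longlonglongrightarrow> x}"

section \<open>Extended-real-valued functions and subdifferentials\<close>

definition indicator_fun :: "'a set \<Rightarrow> 'a \<Rightarrow> ereal" where
  "indicator_fun C x = (if x \<in> C then 0 else \<infinity>)"

definition dom_fun :: "('a \<Rightarrow> ereal) \<Rightarrow> 'a set" where
  "dom_fun f = {x. f x < \<infinity>}"

definition proper_fun :: "('a \<Rightarrow> ereal) \<Rightarrow> bool" where
  "proper_fun f \<longleftrightarrow> (\<forall>x. f x \<noteq> -\<infinity>) \<and> dom_fun f \<noteq> {}"

definition lower_semicontinuous :: "('a::topological_space \<Rightarrow> ereal) \<Rightarrow> bool" where
  "lower_semicontinuous f \<longleftrightarrow> (\<forall>x. f x \<le> Liminf (nhds x) f)"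

definition regular_subdiff :: "('a::euclidean_space \<Rightarrow> ereal) \<Rightarrow> 'a \<Rightarrow> 'a set" where
  "regular_subdiff f xb = {v. xb \<in> dom_fun f \<and>
     Liminf (at xb) (\<lambda>x. (f x - f xb - ereal (v \<bullet> (x - xb))) / ereal (norm (x - xb))) \<ge> 0}"

definition subdiff :: "('a::euclidean_space \<Rightarrow> ereal) \<Rightarrow> 'a \<Rightarrow> 'a set" where
  "subdiff f xb = {v. xb \<in> dom_fun f \<and>
     (\<exists>X V. X \<longlonglongrightarrow> xb \<and> (\<lambda>t. f (X t)) \<longlonglongrightarrow> f xb \<and> V \<longlonglongrightarrow> v \<and>
        (\<forall>t::nat. V t \<in> regular_subdiff f (X t)))}"

section \<open>The Kurdyka-Lojasiewicz property\<close>

text \<open>The library function infdist maps the empty set to 0; the infimum in the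
  extended reals gives the convention that the distance to the empty set is infinite.\<close>

definition edist_set :: "'a::euclidean_space \<Rightarrow> 'a set \<Rightarrow> ereal" where
  "edist_set x S = (INF u\<in>S. ereal (norm (x - u)))"

definition KL_property_at :: "('a::euclidean_space \<Rightarrow> ereal) \<Rightarrow> 'a \<Rightarrow> bool" where
  "KL_property_at f xb \<longleftrightarrow>
     (\<exists>U (s::ereal) (\<psi>::real \<Rightarrow> real) \<psi>'. open U \<and> xb \<in> U \<and> 0 < s \<and>
        continuous_on {r. 0 \<le> r \<and> ereal r < s} \<psi> \<and>
        concave_on {r. 0 \<le> r \<and> ereal r < s} \<psi> \<and>
        (\<forall>r. 0 \<le> r \<and> ereal r < s \<longrightarrow> 0 \<le> \<psi> r) \<and>
        \<psi> 0 = 0 \<and>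
        (\<forall>r. 0 < r \<and> ereal r < s \<longrightarrow> (\<psi> has_real_derivative \<psi>' r) (at r)) \<and>
        continuous_on {r. 0 < r \<and> ereal r < s} \<psi>' \<and>
        (\<forall>r. 0 < r \<and> ereal r < s \<longrightarrow> 0 < \<psi>' r) \<and>
        (\<forall>x\<in>U. f xb < f x \<and> f x < f xb + s \<longrightarrow>
           ereal (\<psi>' (real_of_ereal (f x - f xb))) * edist_set 0 (subdiff f x) \<ge> 1))"

definition KL_function :: "('a::euclidean_space \<Rightarrow> ereal) \<Rightarrow> bool" where
  "KL_function f \<longleftrightarrow> proper_fun f \<and> lower_semicontinuous f \<and>
     (\<forall>x. subdiff f x \<noteq> {} \<longrightarrow> KL_property_at f x)"

section \<open>Continuous differentiability with locally Lipschitz gradient at a point\<close>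

definition C1_lipschitz_gradient_at :: "('a::euclidean_space \<Rightarrow> real) \<Rightarrow> 'a \<Rightarrow> bool" where
  "C1_lipschitz_gradient_at h yb \<longleftrightarrow>
     (\<exists>U g. open U \<and> yb \<in> U \<and> (\<forall>y\<in>U. GDERIV h y :> g y) \<and> continuous_on U g \<and>
        (\<exists>V K. open V \<and> yb \<in> V \<and> V \<subseteq> U \<and> K-lipschitz_on V g))"

section \<open>The objective and the algorithm\<close>

definition feas_objective ::
  "real^'n^'m \<Rightarrow> (real^'n) set \<Rightarrow> (real^'m) set \<Rightarrow> real^'n \<Rightarrow> ereal" where
  "feas_objective A C D x = ereal (1/2 * (infdist (A *v x) D)\<^sup>2) + indicator_fun C x"

text \<open>The truncated subtraction on the natural numbers makes the lower index the
  positive part of t - M.\<close>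

definition ls_test ::
  "real^'n^'m \<Rightarrow> (real^'m) set \<Rightarrow> real \<Rightarrow> nat \<Rightarrow> (nat \<Rightarrow> real^'n) \<Rightarrow> nat \<Rightarrow> real^'n \<Rightarrow> bool"
where
  "ls_test A D c M x t u \<longleftrightarrow>
     (infdist (A *v u) D)\<^sup>2
       \<le> (MAX i\<in>{t - M..t}. (infdist (A *v x i) D)\<^sup>2) - c * (norm (u - x t))\<^sup>2"

definition ls_trial ::
  "real^'n^'m \<Rightarrow> (real^'n) set \<Rightarrow> (real^'m) set \<Rightarrow> real^'n \<Rightarrow> real \<Rightarrow> real^'n \<Rightarrow> bool"
where
  "ls_trial A C D xt L u \<longleftrightarrow>
     (\<exists>\<eta>\<in>Proj D (A *v xt).
        u \<in> Proj C (xt - (1 / L) *\<^sub>R (transpose A *v (A *v xt - \<eta>))))"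

text \<open>The predicate below holds for L, L' and u if the inner loop at iteration t, entered
  with the value L, can stop after finitely many trials with the final value L' and the
  accepted point u. Every trial makes a fresh choice of both projections.\<close>

inductive line_search ::
  "real^'n^'m \<Rightarrow> (real^'n) set \<Rightarrow> (real^'m) set \<Rightarrow> real \<Rightarrow> real \<Rightarrow> nat \<Rightarrow> (nat \<Rightarrow> real^'n) \<Rightarrow> nat
     \<Rightarrow> real \<Rightarrow> real \<Rightarrow> real^'n \<Rightarrow> bool"
  for A C D \<tau> c M x t
where
  accept: "ls_trial A C D (x t) L u \<Longrightarrow> ls_test A D c M x t u
     \<Longrightarrow> line_search A C D \<tau> c M x t L L u"
| reject: "ls_trial A C D (x t) L w \<Longrightarrow> \<not> ls_test A D c M x t w
     \<Longrightarrow> line_search A C D \<tau> c M x t (\<tau> * L) L' u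
     \<Longrightarrow> line_search A C D \<tau> c M x t L L' u"

definition SpFeas_sequence ::
  "real^'n^'m \<Rightarrow> (real^'n) set \<Rightarrow> (real^'m) set \<Rightarrow> real \<Rightarrow> real \<Rightarrow> real \<Rightarrow> real \<Rightarrow> nat
     \<Rightarrow> (nat \<Rightarrow> real^'n) \<Rightarrow> bool"
where
  "SpFeas_sequence A C D Lmin Lmax \<tau> c M x \<longleftrightarrow> x 0 \<in> C \<and>
     (\<forall>t. \<exists>L0\<in>{Lmin..Lmax}. \<exists>L'. line_search A C D \<tau> c M x t L0 L' (x (Suc t)))"

definition seq_accumulation_point :: "(nat \<Rightarrow> 'a::topological_space) \<Rightarrow> 'a \<Rightarrow> bool" where
  "seq_accumulation_point x l \<longleftrightarrow> (\<exists>r::nat \<Rightarrow> nat. strict_mono r \<and> (x \<circ> r) \<longlonglongrightarrow> l)"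

end

theory Submission
  imports Defs
begin

text \<open>
  Write h for half the squared distance to D and f x for h (A x). Two elementary facts about h drive
  everything. If \<eta> is a projection of y onto D, then h lies below z \<mapsto> |z - \<eta>|^2 / 2, with equality
  at y. Expanding this model at y gives a quadratic upper bound for h that is valid on the whole space,
  even for nonconvex D (\<open>half_infdist_sq_upper_model\<close>). Moreover,
  wherever h is differentiable, its gradient must agree with that of the touching model, so it is
  y - \<eta> (\<open>GDERIV_half_infdist_sq\<close>).

  The upper bound makes every trial with parameter at least |A|^2 + c pass the line search test,
  so the accepted parameters are bounded along the whole run (\<open>line_search_bounded\<close>). For M = 0 the
  test is a sufficient decrease of f, so the iterates stay in a sublevel set of f in C. Such a set is
  bounded: normalising an unbounded sequence in it would produce a unit vector of the horizon cone of C
  whose image under A is in the horizon cone of D (\<open>bounded_sublevel_of_horizon_condition\<close>).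

  Near A x*, where h is smooth, the vector A^T(\<eta> - A x^t) in the projected step is minus the gradient
  of f, and the optimality of the projection onto C yields the subgradient
  grad f(x^{t+1}) - grad f(x^t) - L_t (x^{t+1} - x^t) of the objective at x^{t+1}
  (\<open>step_regular_subgradient\<close>). Its norm is at most a constant times the length of the step, because
  the gradient is Lipschitz and L_t is bounded. In particular 0 is a limiting subgradient at x*, so the
  Kurdyka-Lojasiewicz (KL) inequality is available there.

  What remains is a general fact about descent methods (\<open>KL_descent_convergent\<close>). Sufficient decrease,
  the subgradient bound and the KL inequality together bound each step by half of the previous
  one plus a telescoping term. A late iterate close enough to x* therefore traps all later ones
  near x*, and the trajectory has finite length (\<open>convergent_of_lyapunov_step\<close>).
\<close>

section \<open>Convergence of sequences of finite length\<close>

text \<open>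
  The step inequality is only known while the sequence stays in a ball, so the finite length of the
  trajectory and its confinement to the ball have to be shown together. Both follow from the potential
  P n = |step n| + 2 \<phi> n: the inequality says P (n+1) + |step (n+1)| \<le> P n, so P
  pays for all future steps. Confinement holds as soon as the distance to the accumulation point plus P
  is below the radius, which happens at some late time since P tends to 0.
\<close>

lemma convergent_of_lyapunov_step:
  fixes x :: "nat \<Rightarrow> 'a::complete_space" and \<phi> :: "nat \<Rightarrow> real"
  assumes acc: "seq_accumulation_point x xs" and r: "r > 0"
    and phi0: "\<And>n. n \<ge> T0 \<Longrightarrow> 0 \<le> \<phi> n" and philim: "\<phi> \<longlonglongrightarrow> 0"
    and dlim: "(\<lambda>n. dist (x n) (x (Suc n))) \<longlonglongrightarrow> 0"
    and step: "\<And>n. n \<ge> T0 \<Longrightarrow> dist (x n) xs < r \<Longrightarrow> dist (x (Suc n)) xs < r \<Longrightarrow>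
       dist (x (Suc n)) (x (Suc (Suc n))) \<le> dist (x n) (x (Suc n)) / 2 + (\<phi> n - \<phi> (Suc n))"
  shows "convergent x"
proof -
  define \<Delta> where "\<Delta> n = dist (x n) (x (Suc n))" for n
  define P where "P n = \<Delta> n + 2 * \<phi> n" for n
  obtain q where q: "strict_mono q" and xq: "(x \<circ> q) \<longlonglongrightarrow> xs"
    using acc unfolding seq_accumulation_point_def by blast
  have "(\<lambda>n. \<Delta> n + P n) \<longlonglongrightarrow> 0 + (0 + 2 * 0)"
    unfolding P_def using dlim philim unfolding \<Delta>_def by (intro tendsto_intros)
  from LIMSEQ_subseq_LIMSEQ[OF this q] have "(\<lambda>k. \<Delta> (q k) + P (q k)) \<longlonglongrightarrow> 0"
    by (simp add: o_def)
  moreover have "(\<lambda>k. dist (x (q k)) xs) \<longlonglongrightarrow> 0"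
    using tendsto_dist_iff[THEN iffD1, OF xq] by (simp add: o_def)
  ultimately have "(\<lambda>k. dist (x (q k)) xs + (\<Delta> (q k) + P (q k))) \<longlonglongrightarrow> 0 + 0"
    by (intro tendsto_add)
  then have "\<forall>\<^sub>F k in sequentially. dist (x (q k)) xs + (\<Delta> (q k) + P (q k)) < r"
    using r by (auto dest: order_tendstoD)
  then obtain k where k: "k \<ge> T0" "dist (x (q k)) xs + (\<Delta> (q k) + P (q k)) < r"
    unfolding eventually_sequentially by (metis nle_le)
  define T where "T = q k"
  have T: "T \<ge> T0" using k(1) seq_suble[OF q, of k] by (simp add: T_def)
  have P0: "P n \<ge> 0" and D0: "\<Delta> n \<ge> 0" if "n \<ge> T" for n
    using phi0[of n] that T by (auto simp: P_def \<Delta>_def)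
  \<comment> \<open>The potential at time T + n is added to the distance one step later: the step from T + n to its
    successor is already taken, and P bounds only those after it.\<close>
  have inv: "dist (x (T + n)) xs < r \<and> dist (x (Suc (T + n))) xs + P (T + n) < r" for n
  proof (induction n)
    case 0
    have "dist (x (Suc T)) xs \<le> \<Delta> T + dist (x T) xs"
      unfolding \<Delta>_def by (metis dist_commute dist_triangle)
    then show ?case using k(2) P0[of T] D0[of T] by (simp add: T_def)
  next
    case (Suc n)
    have near: "dist (x (Suc (T + n))) xs < r" using Suc P0[of "T + n"] by simp
    then have "\<Delta> (Suc (T + n)) + P (Suc (T + n)) \<le> P (T + n)"
      using step[of "T + n"] Suc T by (simp add: \<Delta>_def P_def)
    moreover have "dist (x (Suc (Suc (T + n)))) xs \<le> \<Delta> (Suc (T + n)) + dist (x (Suc (T + n))) xs"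
      unfolding \<Delta>_def by (metis dist_commute dist_triangle)
    ultimately show ?case using Suc near by simp
  qed
  have dec: "\<Delta> (T + Suc n) + P (T + Suc n) \<le> P (T + n)" for n
    using step[of "T + n"] inv[of n] inv[of "Suc n"] T by (simp add: \<Delta>_def P_def)
  have "(\<Sum>i<n. \<Delta> (T + Suc i)) + P (T + n) \<le> P T" for n
  proof (induction n)
    case (Suc n) then show ?case using dec[of n] by simp
  qed simp
  then have "(\<Sum>i<n. \<Delta> (T + Suc i)) \<le> P T" for n
    by (smt (verit) P0 le_add1)
  then have "summable (\<lambda>i. \<Delta> (T + Suc i))"
    by (intro summableI_nonneg_bounded) (auto simp: \<Delta>_def)
  then have sm: "summable (\<lambda>i. dist (x (i + Suc T)) (x (Suc i + Suc T)))"
    by (simp add: \<Delta>_def add.commute)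
  have "Cauchy (\<lambda>i. x (i + Suc T))"
    unfolding Cauchy_altdef2
  proof (intro allI impI)
    fix e :: real assume "e > 0"
    then obtain N where N: "\<And>m n. m \<ge> N \<Longrightarrow>
        norm (sum (\<lambda>i. dist (x (i + Suc T)) (x (Suc i + Suc T))) {m..<n}) < e"
      using sm unfolding summable_Cauchy by blast
    have tri: "dist (x (N + j + Suc T)) (x (N + Suc T))
        \<le> sum (\<lambda>i. dist (x (i + Suc T)) (x (Suc i + Suc T))) {N..<N + j}" for j
    proof (induction j)
      case (Suc j)
      have "dist (x (N + Suc j + Suc T)) (x (N + Suc T))
        \<le> dist (x (N + j + Suc T)) (x (Suc (N + j) + Suc T)) + dist (x (N + j + Suc T)) (x (N + Suc T))"
        by (metis add_Suc_right dist_commute dist_triangle)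
      then show ?case using Suc by simp
    qed simp
    show "\<exists>N. \<forall>n\<ge>N. dist (x (n + Suc T)) (x (N + Suc T)) < e"
    proof (intro exI[of _ N] allI impI)
      fix n assume "N \<le> n"
      then obtain j where "n = N + j" using le_Suc_ex by blast
      then show "dist (x (n + Suc T)) (x (N + Suc T)) < e"
        using tri[of j] N[of N "N + j"] by (simp add: real_norm_def abs_of_nonneg sum_nonneg)
    qed
  qed
  then have "convergent (\<lambda>i. x (i + Suc T))" by (rule Cauchy_convergent)
  then show ?thesis by (metis convergent_ignore_initial_segment)
qed

section \<open>Descent methods under the Kurdyka-Lojasiewicz property\<close>

text \<open>The tangent inequality is applied on an open interval I inside the domain S, because a KL
  desingularising function is differentiable only away from the left end 0 of its domain.\<close>

lemma concave_on_tangent_decrease: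
  fixes \<psi> :: "real \<Rightarrow> real"
  assumes "concave_on S \<psi>" "open I" "convex I" "I \<subseteq> S" "u \<in> I" "v \<in> I"
    and "(\<psi> has_real_derivative p) (at u)"
  shows "p * (u - v) \<le> \<psi> u - \<psi> v"
proof -
  have "convex_on I (\<lambda>z. - \<psi> z)"
    using assms(1,3,4) convex_on_subset unfolding concave_on_def by blast
  moreover have "((\<lambda>z. - \<psi> z) has_real_derivative - p) (at u within I)"
    using assms(7) by (intro DERIV_minus) (rule has_field_derivative_at_within)
  ultimately have "- \<psi> v - - \<psi> u \<ge> - p * (v - u)"
    using assms by (intro convex_on_imp_above_tangent[of I])
      (auto simp: convex_connected interior_open)
  then show ?thesis by (simp add: algebra_simps)
qed

lemma steps_vanish_of_sufficient_decrease:
  fixes x :: "nat \<Rightarrow> 'a::real_normed_vector"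
  assumes hlim: "h \<longlonglongrightarrow> hs" and a: "a > 0"
    and dec: "\<And>t. h (Suc t) + a * (norm (x (Suc t) - x t))\<^sup>2 \<le> h t"
  shows "(\<lambda>t. x (Suc t) - x t) \<longlonglongrightarrow> 0"
proof -
  have "(\<lambda>t. (h t - h (Suc t)) / a) \<longlonglongrightarrow> (hs - hs) / a"
    using hlim LIMSEQ_Suc[OF hlim] a by (intro tendsto_intros) auto
  then have lim: "(\<lambda>t. (h t - h (Suc t)) / a) \<longlonglongrightarrow> 0" by simp
  have "(\<lambda>t. (norm (x (Suc t) - x t))\<^sup>2) \<longlonglongrightarrow> 0"
  proof (rule tendsto_sandwich[OF _ _ tendsto_const lim])
    show "\<forall>\<^sub>F t in sequentially. (norm (x (Suc t) - x t))\<^sup>2 \<le> (h t - h (Suc t)) / a"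
      using dec a by (simp add: field_simps)
  qed simp
  then have "(\<lambda>t. norm (x (Suc t) - x t)) \<longlonglongrightarrow> 0"
    using tendsto_real_sqrt by fastforce
  then show ?thesis by (simp add: tendsto_norm_zero_iff)
qed

text \<open>
  If h attains its limit hs at some index, the decrease forces all later steps to vanish. Otherwise let \<psi> be the
  desingularising function, e_n = h(n) - hs, d_n = |x(n+1) - x(n)|, and let q be the drop of \<psi> from
  e_{n+1} to e_{n+2}. Concavity and the decrease give a \<psi>'(e_{n+1}) d_{n+1}^2 \<le> q, while the KL inequality
  and the subgradient bound give 1 \<le> \<psi>'(e_{n+1}) b d_n. Multiplying eliminates the unknown \<psi>':
  d_{n+1}^2 \<le> d_n (b/a) q, and the inequality of the arithmetic and the geometric mean turns this into the
  step inequality of the preceding section with \<phi> n = b/(2a) \<psi>(e_{n+1}).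
\<close>

lemma KL_descent_convergent:
  fixes x :: "nat \<Rightarrow> 'a::euclidean_space" and F :: "'a \<Rightarrow> ereal"
  assumes KL: "KL_property_at F xs" and acc: "seq_accumulation_point x xs"
    and Fx: "\<And>t. F (x t) = ereal (h t)" and Fs: "F xs = ereal hs" and hlim: "h \<longlonglongrightarrow> hs"
    and a: "a > 0" and dec: "\<And>t. h (Suc t) + a * (norm (x (Suc t) - x t))\<^sup>2 \<le> h t"
    and b: "b > 0" and \<rho>: "\<rho> > 0"
    and err: "\<And>t. dist (x t) xs < \<rho> \<Longrightarrow> dist (x (Suc t)) xs < \<rho> \<Longrightarrow>
        \<exists>v \<in> subdiff F (x (Suc t)). norm v \<le> b * norm (x (Suc t) - x t)"
  shows "convergent x"
proof -
  have "h (Suc t) \<le> h t" for t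
    using dec[of t] a by (smt (verit) mult_nonneg_nonneg zero_le_power2)
  then have hdec: "decseq h" by (rule decseq_SucI)
  then have hge: "h t \<ge> hs" for t using hlim by (rule decseq_ge)
  show ?thesis
  proof (cases "\<exists>t. h t = hs")
    case True
    then obtain t where t: "h t = hs" by blast
    have heq: "h n = hs" if "n \<ge> t" for n
      using decseqD[OF hdec that] t hge[of n] by simp
    have "x (Suc n) = x n" if "n \<ge> t" for n
      using dec[of n] heq[of n] heq[of "Suc n"] that a
      by (simp add: mult_le_0_iff)
    then have stay: "x (Suc n) = x n" if "n \<ge> t" for n using that by blast
    have "x n = x t" if "n \<ge> t" for n
      using that by (induction n rule: dec_induct) (auto simp: stay)
    then have "\<forall>\<^sub>F n in sequentially. x n = x t"
      unfolding eventually_sequentially by blast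
    then show ?thesis
      using tendsto_eventually convergentI by metis
  next
    case False
    then have hgt: "h t > hs" for t using hge[of t] by (metis order_le_less)
    obtain U s \<psi> \<psi>' where U: "open U" "xs \<in> U" and s: "0 < s"
      and cont: "continuous_on {r. 0 \<le> r \<and> ereal r < s} \<psi>"
      and conc: "concave_on {r. 0 \<le> r \<and> ereal r < s} \<psi>"
      and \<psi>nn: "\<forall>r. 0 \<le> r \<and> ereal r < s \<longrightarrow> 0 \<le> \<psi> r" and \<psi>0: "\<psi> 0 = 0"
      and der: "\<forall>r. 0 < r \<and> ereal r < s \<longrightarrow> (\<psi> has_real_derivative \<psi>' r) (at r)"
      and "continuous_on {r. 0 < r \<and> ereal r < s} \<psi>'"
      and \<psi>'pos: "\<forall>r. 0 < r \<and> ereal r < s \<longrightarrow> 0 < \<psi>' r"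
      and ineq: "\<forall>y\<in>U. F xs < F y \<and> F y < F xs + s \<longrightarrow>
         ereal (\<psi>' (real_of_ereal (F y - F xs))) * edist_set 0 (subdiff F y) \<ge> 1"
      using KL unfolding KL_property_at_def by (elim exE conjE) (rule that)
    obtain e where e: "e > 0" "ball xs e \<subseteq> U" using U by (meson openE)
    define g where "g t = h t - hs" for t
    have g0: "g t > 0" for t using hgt[of t] by (simp add: g_def)
    have glim: "g \<longlonglongrightarrow> 0" unfolding g_def using tendsto_diff[OF hlim tendsto_const[of hs]] by simp
    have "(\<lambda>t. ereal (g t)) \<longlonglongrightarrow> ereal 0" using glim by (rule tendsto_ereal)
    then have "\<forall>\<^sub>F t in sequentially. ereal (g t) < s"
      using s by (intro order_tendstoD) (simp_all add: zero_ereal_def)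
    then obtain T0 where gs: "\<And>t. t \<ge> T0 \<Longrightarrow> ereal (g t) < s"
      unfolding eventually_sequentially by blast
    define \<phi> where "\<phi> n = b / (2 * a) * \<psi> (g (Suc n))" for n
    have "((\<lambda>n. \<psi> (g n)) \<longlongrightarrow> \<psi> 0) sequentially"
    proof (rule continuous_on_tendsto_compose[OF cont glim])
      show "0 \<in> {r. 0 \<le> r \<and> ereal r < s}" using s by (simp add: zero_ereal_def)
      show "\<forall>\<^sub>F n in sequentially. g n \<in> {r. 0 \<le> r \<and> ereal r < s}"
        unfolding eventually_sequentially using gs g0 by (auto intro: less_imp_le)
    qed
    then have "(\<lambda>n. \<psi> (g (Suc n))) \<longlonglongrightarrow> 0" using \<psi>0 LIMSEQ_Suc by fastforce
    then have philim: "\<phi> \<longlonglongrightarrow> 0" unfolding \<phi>_def by (rule tendsto_mult_right_zero)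
    have phi0: "0 \<le> \<phi> n" if "n \<ge> T0" for n
      unfolding \<phi>_def using a b \<psi>nn[rule_format, of "g (Suc n)"] gs[of "Suc n"] g0[of "Suc n"] that
      by simp
    have dlim: "(\<lambda>n. dist (x n) (x (Suc n))) \<longlonglongrightarrow> 0"
      using tendsto_norm_zero[OF steps_vanish_of_sufficient_decrease[OF hlim a dec]]
      by (simp add: dist_norm norm_minus_commute)
    have opn: "open {r. 0 < r \<and> ereal r < s}"
      by (intro open_Collect_conj open_Collect_less continuous_intros)
    have cvx: "convex {r. 0 < r \<and> ereal r < s}"
      unfolding is_interval_convex_1[symmetric] is_interval_1
      by (auto intro: le_less_trans[of "ereal _" "ereal _"])
    show ?thesis
    proof (rule convergent_of_lyapunov_step[OF acc, where \<phi> = \<phi> and ?T0.0 = T0 and r = "min e \<rho>"])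
      show "min e \<rho> > 0" using e \<rho> by simp
    next
      fix n assume n: "T0 \<le> n" "dist (x n) xs < min e \<rho>" "dist (x (Suc n)) xs < min e \<rho>"
      define d where "d k = norm (x (Suc k) - x k)" for k
      define p where "p = \<psi>' (g (Suc n))"
      have p: "p > 0" unfolding p_def using \<psi>'pos g0 gs n by simp
      obtain v where v: "v \<in> subdiff F (x (Suc n))" "norm v \<le> b * d n"
        using err[of n] n unfolding d_def by auto
      have "x (Suc n) \<in> U" using e n by (auto simp: dist_commute)
      moreover have "F xs < F (x (Suc n))" using Fs Fx hgt by simp
      moreover have "F (x (Suc n)) < F xs + s"
        using gs[of "Suc n"] n(1) unfolding Fs Fx g_def
        by (cases s) (auto simp: algebra_simps)
      ultimately have "ereal (\<psi>' (real_of_ereal (F (x (Suc n)) - F xs)))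
           * edist_set 0 (subdiff F (x (Suc n))) \<ge> 1" using ineq by blast
      then have 1: "1 \<le> ereal p * edist_set 0 (subdiff F (x (Suc n)))"
        unfolding Fx Fs p_def g_def by simp
      have 2: "edist_set 0 (subdiff F (x (Suc n))) \<le> ereal (norm v)"
        unfolding edist_set_def using v(1) by (intro INF_lower2[of v]) auto
      have "1 \<le> ereal p * ereal (norm v)"
        using order_trans[OF 1 ereal_mult_left_mono[OF 2]] p by simp
      then have "1 \<le> p * norm v" by (simp add: one_ereal_def)
      also have "\<dots> \<le> p * (b * d n)" using v(2) p by (simp add: mult_left_mono)
      finally have one: "1 \<le> p * (b * d n)" .
      have "p * (g (Suc n) - g (Suc (Suc n))) \<le> \<psi> (g (Suc n)) - \<psi> (g (Suc (Suc n)))"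
        unfolding p_def using g0 gs n(1)
        by (intro concave_on_tangent_decrease[OF conc opn cvx]) (auto simp: der)
      moreover have "a * (d (Suc n))\<^sup>2 \<le> g (Suc n) - g (Suc (Suc n))"
        using dec[of "Suc n"] by (simp add: d_def g_def)
      ultimately have conc': "p * (a * (d (Suc n))\<^sup>2) \<le> \<psi> (g (Suc n)) - \<psi> (g (Suc (Suc n)))"
        using p by (smt (verit) mult_left_mono)
      define w where "w = b / a * (\<psi> (g (Suc n)) - \<psi> (g (Suc (Suc n))))"
      have w: "w / 2 = \<phi> n - \<phi> (Suc n)" using a by (simp add: w_def \<phi>_def field_simps)
      have d0: "d k \<ge> 0" for k by (simp add: d_def)
      have "a * (d (Suc n))\<^sup>2 * 1 \<le> a * (d (Suc n))\<^sup>2 * (p * (b * d n))"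
        using one a by (intro mult_left_mono) auto
      also have "\<dots> = (b * d n) * (p * (a * (d (Suc n))\<^sup>2))" by (simp add: algebra_simps)
      also have "\<dots> \<le> (b * d n) * (\<psi> (g (Suc n)) - \<psi> (g (Suc (Suc n))))"
        using conc' b d0 by (intro mult_left_mono) auto
      finally have "(d (Suc n))\<^sup>2 \<le> d n * w"
        using a by (simp add: w_def field_simps)
      moreover have "w \<ge> 0"
        unfolding w_def using conc' a b p
        by (intro mult_nonneg_nonneg) (smt (verit) divide_nonneg_nonneg mult_nonneg_nonneg zero_le_power2)+
      ultimately have "(d (Suc n))\<^sup>2 \<le> (d n / 2 + w / 2)\<^sup>2"
        using zero_le_power2[of "d n - w"] by (simp add: power2_eq_square algebra_simps)
      then have "d (Suc n) \<le> d n / 2 + w / 2"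
        by (rule power2_le_imp_le) (use d0 \<open>w \<ge> 0\<close> in auto)
      then show "dist (x (Suc n)) (x (Suc (Suc n))) \<le> dist (x n) (x (Suc n)) / 2 + (\<phi> n - \<phi> (Suc n))"
        unfolding w[symmetric] by (simp add: d_def dist_norm norm_minus_commute)
    qed (use phi0 philim dlim in auto)
  qed
qed

section \<open>Subgradients of a differentiable function on a closed set\<close>

text \<open>
  The hypothesis on q says that q is a proximal normal to C at u: its first-order gain along C is of
  second order. The objective is infinite off C, so only points of C matter for the lower limit, and
  there the errors of both terms are o(|z - u|).
\<close>

lemma regular_subdiff_plus_indicator:
  fixes f :: "'a::euclidean_space \<Rightarrow> real"
  assumes grad: "GDERIV f u :> p" and u: "u \<in> C"
    and prox: "\<And>z. z \<in> C \<Longrightarrow> q \<bullet> (z - u) \<le> K * (norm (z - u))\<^sup>2"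
  shows "p + q \<in> regular_subdiff (\<lambda>z. ereal (f z) + indicator_fun C z) u"
proof -
  let ?F = "\<lambda>z. ereal (f z) + indicator_fun C z"
  have Fu: "?F u = ereal (f u)" using u by (simp add: indicator_fun_def)
  have "0 \<le> Liminf (at u) (\<lambda>z. (?F z - ?F u - ereal ((p + q) \<bullet> (z - u))) / ereal (norm (z - u)))"
    unfolding le_Liminf_iff
  proof (intro allI impI)
    fix y :: ereal assume "y < 0"
    then obtain e where e: "e > 0" "y \<le> ereal (- e)"
      by (metis ereal_dense2 less_ereal.simps(1) less_imp_le neg_0_less_iff_less zero_ereal_def
          minus_minus)
    have "((\<lambda>z. (f z - f u - (z - u) \<bullet> p) / norm (z - u)) \<longlongrightarrow> 0) (at u)"
      using grad unfolding gderiv_def has_derivative_at2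
      by (simp add: divide_inverse mult.commute algebra_simps)
    then have 1: "\<forall>\<^sub>F z in at u. (f z - f u - (z - u) \<bullet> p) / norm (z - u) > - (e/2)"
      using e by (intro order_tendstoD) auto
    have "((\<lambda>z. \<bar>K\<bar> * norm (z - u)) \<longlongrightarrow> \<bar>K\<bar> * norm (u - u)) (at u)"
      by (intro tendsto_intros)
    then have 2: "\<forall>\<^sub>F z in at u. \<bar>K\<bar> * norm (z - u) < e/2"
      using e by (intro order_tendstoD) auto
    show "\<forall>\<^sub>F z in at u. y < (?F z - ?F u - ereal ((p + q) \<bullet> (z - u))) / ereal (norm (z - u))"
      using 1 2 eventually_neq_at_within[of u]
    proof eventually_elim
      case (elim z)
      then have nz: "norm (z - u) > 0" by simp
      show ?case
      proof (cases "z \<in> C")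
        case True
        have "q \<bullet> (z - u) \<le> \<bar>K\<bar> * norm (z - u) * norm (z - u)"
          using prox[OF True] by (smt (verit) mult_right_mono power2_eq_square zero_le_power2 mult.assoc)
        also have "\<dots> \<le> e/2 * norm (z - u)" using elim(2) nz by (intro mult_right_mono) auto
        finally have "q \<bullet> (z - u) \<le> e/2 * norm (z - u)" .
        moreover have "f z - f u - (z - u) \<bullet> p > - (e/2) * norm (z - u)"
          using elim(1) nz by (simp add: field_simps)
        ultimately have "f z - f u - (p + q) \<bullet> (z - u) > - e * norm (z - u)"
          by (simp add: inner_add_left inner_commute algebra_simps)
        then have "- e < (f z - f u - (p + q) \<bullet> (z - u)) / norm (z - u)"
          using nz by (simp add: field_simps)
        then have "y < ereal ((f z - f u - (p + q) \<bullet> (z - u)) / norm (z - u))"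
          using e(2) by (meson le_less_trans less_ereal.simps(1))
        then show ?thesis using True u nz by (auto simp: indicator_fun_def)
      next
        case False
        then have "(?F z - ?F u - ereal ((p + q) \<bullet> (z - u))) / ereal (norm (z - u)) = \<infinity>"
          using nz Fu by (simp add: indicator_fun_def divide_ereal_def)
        then show ?thesis using e(2) by (metis ereal_infty_less(1) ereal_infty_less_eq(1) MInfty_neq_PInfty(1) PInfty_neq_ereal(1))
      qed
    qed
  qed
  then show ?thesis unfolding regular_subdiff_def dom_fun_def using u by (simp add: indicator_fun_def)
qed

lemma regular_subdiff_imp_subdiff: "v \<in> regular_subdiff f u \<Longrightarrow> v \<in> subdiff f u"
  unfolding subdiff_def mem_Collect_eq
  by (intro conjI exI[where x = "\<lambda>_. u"] exI[where x = "\<lambda>_. v"]) (auto simp: regular_subdiff_def)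

text \<open>The subdifferential asks for regular subgradients along the whole sequence; dropping an initial
  segment makes an eventual condition enough.\<close>

lemma subdiff_limit_of_regular:
  assumes "f u < \<infinity>" "X \<longlonglongrightarrow> u" "(\<lambda>t. f (X t)) \<longlonglongrightarrow> f u" "V \<longlonglongrightarrow> v"
    and "\<forall>\<^sub>F t in sequentially. V t \<in> regular_subdiff f (X t)"
  shows "v \<in> subdiff f u"
proof -
  obtain N where N: "\<And>t. t \<ge> N \<Longrightarrow> V t \<in> regular_subdiff f (X t)"
    using assms(5) unfolding eventually_sequentially by blast
  show ?thesis
    unfolding subdiff_def dom_fun_def mem_Collect_eq
    using assms(1) LIMSEQ_ignore_initial_segment[OF assms(2), of N]
      LIMSEQ_ignore_initial_segment[OF assms(3), of N]
      LIMSEQ_ignore_initial_segment[OF assms(4), of N] N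
    by (intro conjI exI[where x = "\<lambda>t. X (t + N)"] exI[where x = "\<lambda>t. V (t + N)"]) auto
qed

section \<open>Projections and the squared distance\<close>

lemma Proj_mem: "y \<in> Proj S w \<Longrightarrow> y \<in> S"
  by (simp add: Proj_def is_arg_min_def)

lemma infdist_eq_Proj: "y \<in> Proj S w \<Longrightarrow> infdist w S = norm (w - y)"
proof -
  assume y: "y \<in> Proj S w"
  then have "y \<in> S" by (rule Proj_mem)
  then have "norm (w - y) \<le> infdist w S"
    using y unfolding infdist_def Proj_def is_arg_min_def
    by (auto intro!: cINF_greatest simp: dist_norm norm_minus_commute not_less)
  then show ?thesis using infdist_le[OF \<open>y \<in> S\<close>, of w] by (simp add: dist_norm)
qed

text \<open>Comparing the squared distances of u and z to w and expanding about u leaves exactly this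
  inequality. For a nonconvex set the quadratic term cannot be dropped.\<close>

lemma Proj_proximal_normal:
  assumes "u \<in> Proj C w" "z \<in> C"
  shows "(w - u) \<bullet> (z - u) \<le> 1/2 * (norm (z - u))\<^sup>2"
proof -
  have "norm (u - w) \<le> norm (z - w)"
    using assms by (auto simp: Proj_def is_arg_min_def not_less)
  then have "(norm (u - w))\<^sup>2 \<le> (norm (z - w))\<^sup>2" by (simp add: power_mono)
  moreover have "(norm (z - w))\<^sup>2 = (norm (u - w))\<^sup>2 - 2 * ((w - u) \<bullet> (z - u)) + (norm (z - u))\<^sup>2"
    using dot_norm_neg[of "w - u" "z - u"] by (simp add: norm_minus_commute)
  ultimately show ?thesis by simp
qed

text \<open>A projection \<eta> of y is one candidate for the nearest point to z, so |z - \<eta>|^2 / 2 is an upper bound;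
  the right-hand side is its expansion at y.\<close>

lemma half_infdist_sq_upper_model:
  assumes "\<eta> \<in> Proj D y"
  shows "1/2 * (infdist z D)\<^sup>2 \<le> 1/2 * (infdist y D)\<^sup>2 + (y - \<eta>) \<bullet> (z - y) + 1/2 * (norm (z - y))\<^sup>2"
proof -
  have "infdist z D \<le> norm (z - \<eta>)"
    using infdist_le[OF Proj_mem[OF assms], of z] by (simp add: dist_norm)
  then have "(infdist z D)\<^sup>2 \<le> (norm (z - \<eta>))\<^sup>2" by (simp add: power_mono infdist_nonneg)
  then show ?thesis unfolding infdist_eq_Proj[OF assms]
    by (simp add: power2_norm_eq_inner algebra_simps inner_commute)
qed

text \<open>The gap between |z - \<eta>|^2 / 2 and half the squared distance of z is nonnegative and vanishes at y, so
  its derivative is zero there.\<close>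

lemma GDERIV_half_infdist_sq:
  fixes D :: "'a::euclidean_space set"
  assumes \<eta>: "\<eta> \<in> Proj D y" and grad: "GDERIV (\<lambda>z. 1/2 * (infdist z D)\<^sup>2) y :> g"
  shows "g = y - \<eta>"
proof -
  let ?h = "\<lambda>z. 1/2 * (infdist z D)\<^sup>2"
  let ?k = "\<lambda>z. 1/2 * ((z - \<eta>) \<bullet> (z - \<eta>)) - ?h z"
  have "(?k has_derivative (\<lambda>w. w \<bullet> (y - \<eta> - g))) (at y)"
  proof -
    have "((\<lambda>z. 1/2 * ((z - \<eta>) \<bullet> (z - \<eta>))) has_derivative (\<lambda>w. w \<bullet> (y - \<eta>))) (at y)"
      by (auto intro!: derivative_eq_intros simp: inner_commute)
    from has_derivative_diff[OF this grad[unfolded gderiv_def]]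
    show ?thesis by (simp only: inner_diff_right)
  qed
  moreover have "?k y \<le> ?k z" for z
    using half_infdist_sq_upper_model[OF \<eta>, of z] unfolding infdist_eq_Proj[OF \<eta>]
    by (simp add: power2_norm_eq_inner algebra_simps inner_commute)
  ultimately have "(\<lambda>w. w \<bullet> (y - \<eta> - g)) = (\<lambda>v. 0)"
    by (intro differential_zero_maxmin[of y UNIV ?k]) auto
  then have "(y - \<eta> - g) \<bullet> (y - \<eta> - g) = 0" by metis
  then show ?thesis by simp
qed

section \<open>One step of the algorithm\<close>

lemma inner_transpose_matrix:
  fixes A :: "real^'n^'m"
  shows "(transpose A *v y) \<bullet> z = y \<bullet> (A *v z)" and "z \<bullet> (transpose A *v y) = (A *v z) \<bullet> y"
  by (simp_all add: dot_lmul_matrix inner_commute[of z] inner_commute[of "A *v z"])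

lemma norm_matrix_le: "norm (A *v z) \<le> onorm ((*v) A) * norm z" for A :: "real^'n^'m"
  by (intro onorm) simp

text \<open>The proximal normal inequality at u, scaled by L so that p enters with coefficient 1. For z = y it
  yields the decrease along the step, and for general z a subgradient at u.\<close>

lemma Proj_gradient_step_proximal_normal:
  assumes L: "L > 0" and u: "u \<in> Proj C (y - (1 / L) *\<^sub>R p)" and z: "z \<in> C"
  shows "(- p - L *\<^sub>R (u - y)) \<bullet> (z - u) \<le> L / 2 * (norm (z - u))\<^sup>2"
proof -
  have "L * ((y - (1 / L) *\<^sub>R p - u) \<bullet> (z - u)) \<le> L * (1/2 * (norm (z - u))\<^sup>2)"
    using Proj_proximal_normal[OF u z] L by (intro mult_left_mono) auto
  moreover have "L * ((y - (1 / L) *\<^sub>R p - u) \<bullet> (z - u)) = (- p - L *\<^sub>R (u - y)) \<bullet> (z - u)"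
    using L by (simp add: algebra_simps)
  ultimately show ?thesis by simp
qed

lemma ls_test_monotone_iff:
  "ls_test A D c 0 x t u \<longleftrightarrow>
     (infdist (A *v u) D)\<^sup>2 \<le> (infdist (A *v x t) D)\<^sup>2 - c * (norm (u - x t))\<^sup>2"
  by (simp add: ls_test_def)

text \<open>The step decreases the linear part of the upper model by L/2 |u - x t|^2, and the quadratic part
  costs at most |A|^2/2 |u - x t|^2. After doubling, the surplus L - |A|^2 must cover c.\<close>

lemma ls_test_of_large_parameter:
  fixes A :: "real^'n^'m"
  assumes tr: "ls_trial A C D (x t) L u" and xC: "x t \<in> C" and L0: "L > 0"
    and L: "L \<ge> (onorm ((*v) A))\<^sup>2 + c"
  shows "ls_test A D c 0 x t u"
proof -
  obtain \<eta> where \<eta>: "\<eta> \<in> Proj D (A *v x t)"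
    and u: "u \<in> Proj C (x t - (1 / L) *\<^sub>R (transpose A *v (A *v x t - \<eta>)))"
    using tr unfolding ls_trial_def by blast
  let ?p = "transpose A *v (A *v x t - \<eta>)" and ?N = "(norm (u - x t))\<^sup>2"
  have "?p \<bullet> (u - x t) \<le> - (L / 2) * ?N"
    using Proj_gradient_step_proximal_normal[OF L0 u xC]
    by (simp add: norm_minus_commute power2_norm_eq_inner inner_diff_left inner_diff_right
        inner_commute algebra_simps)
  moreover have "(infdist (A *v u) D)\<^sup>2 \<le> (infdist (A *v x t) D)\<^sup>2 + 2 * (?p \<bullet> (u - x t))
      + (norm (A *v (u - x t)))\<^sup>2"
    using half_infdist_sq_upper_model[OF \<eta>, of "A *v u"]
    unfolding inner_transpose_matrix unfolding matrix_vector_mult_diff_distrib by simp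
  moreover have "(norm (A *v (u - x t)))\<^sup>2 \<le> (onorm ((*v) A))\<^sup>2 * ?N"
    using power_mono[OF norm_matrix_le[of A "u - x t"], of 2] by (simp add: power_mult_distrib)
  moreover have "((onorm ((*v) A))\<^sup>2 + c) * ?N \<le> L * ?N"
    using L by (intro mult_right_mono) auto
  ultimately show ?thesis
    unfolding ls_test_monotone_iff by (simp add: algebra_simps)
qed

text \<open>A rejected parameter is below the threshold for acceptance, so one multiplication by \<tau> cannot exceed
  \<tau> times that threshold. The bound B is free of x and t, hence common to all iterations.\<close>

lemma line_search_bounded:
  fixes A :: "real^'n^'m"
  assumes "line_search A C D \<tau> c 0 x t L L' u" and "x t \<in> C" and "L > 0" and "\<tau> > 1"
    and "L \<le> B" and "\<tau> * ((onorm ((*v) A))\<^sup>2 + c) \<le> B"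
  shows "ls_trial A C D (x t) L' u \<and> ls_test A D c 0 x t u \<and> 0 < L' \<and> L' \<le> B"
  using assms
proof induction
  case (reject L w L' u)
  have "L < (onorm ((*v) A))\<^sup>2 + c"
    using ls_test_of_large_parameter[of A C D x t L w c] reject by force
  then have "\<tau> * L \<le> \<tau> * ((onorm ((*v) A))\<^sup>2 + c)"
    using reject.prems by (intro mult_left_mono) auto
  then have "\<tau> * L \<le> B" using reject.prems by linarith
  then show ?case using reject by simp
qed auto

text \<open>By differentiability at A y, whichever projection of A y was taken, the step goes along the
  negative gradient of f at y. Hence the proximal normal to C at u contains minus that gradient, and
  adding the gradient of f at u leaves a difference of gradients, small for a short step.\<close>

lemma step_regular_subgradient:
  fixes A :: "real^'n^'m"
  assumes tr: "ls_trial A C D y L u" and L: "L > 0"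
    and gy: "GDERIV (\<lambda>z. 1/2 * (infdist z D)\<^sup>2) (A *v y) :> g (A *v y)"
    and gu: "GDERIV (\<lambda>z. 1/2 * (infdist z D)\<^sup>2) (A *v u) :> g (A *v u)"
  shows "transpose A *v (g (A *v u) - g (A *v y)) - L *\<^sub>R (u - y)
          \<in> regular_subdiff (feas_objective A C D) u"
proof -
  obtain \<eta> where \<eta>: "\<eta> \<in> Proj D (A *v y)"
    and u: "u \<in> Proj C (y - (1 / L) *\<^sub>R (transpose A *v (A *v y - \<eta>)))"
    using tr unfolding ls_trial_def by blast
  have geq: "A *v y - \<eta> = g (A *v y)" using GDERIV_half_infdist_sq[OF \<eta> gy] by simp
  let ?p = "transpose A *v g (A *v y)"
  have grad: "GDERIV (\<lambda>z. 1/2 * (infdist (A *v z) D)\<^sup>2) u :> transpose A *v g (A *v u)"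
  proof -
    have "((*v) A has_derivative (*v) A) (at u)"
      by (rule bounded_linear_imp_has_derivative) simp
    from has_derivative_compose[OF this gu[unfolded gderiv_def]]
    show ?thesis unfolding gderiv_def inner_transpose_matrix .
  qed
  have "transpose A *v g (A *v u) + (- ?p - L *\<^sub>R (u - y))
     \<in> regular_subdiff (\<lambda>z. ereal (1/2 * (infdist (A *v z) D)\<^sup>2) + indicator_fun C z) u"
    using Proj_gradient_step_proximal_normal[OF L u] Proj_mem[OF u] unfolding geq
    by (intro regular_subdiff_plus_indicator[OF grad]) blast+
  then show ?thesis
    by (simp add: feas_objective_def[abs_def] matrix_vector_mult_diff_distrib algebra_simps)
qed

section \<open>Boundedness of sublevel sets\<close>

text \<open>
  From an unbounded sequence y in the set, the scaled points y n / |y n| accumulate at a unit vector z in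
  the horizon cone of C. Nearest points of D to A (y n) differ from A (y n) by at most r, so after the same
  scaling they converge to A z, which puts A z in the horizon cone of D.
\<close>

lemma bounded_sublevel_of_horizon_condition:
  fixes A :: "real^'n^'m"
  assumes "closed D" "D \<noteq> {}"
    and hor: "horizon_cone C \<inter> {z. A *v z \<in> horizon_cone D} \<subseteq> {0}"
  shows "bounded {z \<in> C. infdist (A *v z) D \<le> r}"
proof (rule ccontr)
  let ?S = "{z \<in> C. infdist (A *v z) D \<le> r}"
  assume nb: "\<not> bounded ?S"
  have far: "\<exists>z\<in>?S. norm z > B" for B
    using nb unfolding bounded_iff by (metis not_less)
  \<comment> \<open>Horizon cones require decreasing scalars, hence norms that increase along the sequence.\<close>
  obtain y where y: "\<And>n. y n \<in> ?S \<and> norm (y n) \<ge> 1" and yinc: "\<And>n. norm (y (Suc n)) \<ge> norm (y n) + 1"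
  proof -
    have "\<exists>f. \<forall>n. (f n \<in> ?S \<and> norm (f n) \<ge> 1) \<and> norm (f (Suc n)) \<ge> norm (f n) + 1"
    proof (rule dependent_nat_choice)
      show "\<exists>z. z \<in> ?S \<and> norm z \<ge> 1" using far[of 1] by (meson less_imp_le)
      fix z :: "real^'n" and n :: nat assume "z \<in> ?S \<and> norm z \<ge> 1"
      then show "\<exists>w. (w \<in> ?S \<and> norm w \<ge> 1) \<and> norm w \<ge> norm z + 1"
        using far[of "norm z + 1"] by (smt (verit) norm_ge_zero)
    qed
    then show ?thesis using that by blast
  qed
  have ygrow: "norm (y n) \<ge> real n" for n
  proof (induction n)
    case (Suc n) then show ?case using yinc[of n] by simp
  qed simp
  have ymono: "incseq (\<lambda>n. norm (y n))" using yinc by (intro incseq_SucI) (smt (verit))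
  define \<beta> where "\<beta> n = 1 / norm (y n)" for n
  have \<beta>pos: "\<beta> n > 0" for n using y[of n] by (simp add: \<beta>_def) (metis norm_zero not_one_le_zero)
  have \<beta>dec: "decseq \<beta>" unfolding decseq_def
  proof (intro allI impI)
    fix m n :: nat assume "m \<le> n"
    then show "\<beta> n \<le> \<beta> m" using incseqD[OF ymono, of m n] y[of m] \<beta>pos
      unfolding \<beta>_def by (intro divide_left_mono) (auto intro!: mult_pos_pos)
  qed
  have "filterlim (\<lambda>n. norm (y n)) at_top sequentially"
    by (rule filterlim_at_top_mono[OF filterlim_real_sequentially]) (simp add: ygrow)
  then have \<beta>lim: "\<beta> \<longlonglongrightarrow> 0"
    unfolding \<beta>_def using tendsto_divide_0[OF tendsto_const] filterlim_at_top_imp_at_infinity by blast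
  have unit: "\<beta> n *\<^sub>R y n \<in> sphere 0 1" for n
    using y[of n] by (auto simp: \<beta>_def)
  obtain z q where z: "z \<in> sphere 0 1" and q: "strict_mono q"
    and zlim: "((\<lambda>n. \<beta> n *\<^sub>R y n) \<circ> q) \<longlonglongrightarrow> z"
    using seq_compactE[of "sphere 0 1" "\<lambda>n. \<beta> n *\<^sub>R y n"] unit compact_sphere compact_imp_seq_compact
    by metis
  have zl: "(\<lambda>k. \<beta> (q k) *\<^sub>R y (q k)) \<longlonglongrightarrow> z" using zlim by (simp add: o_def)
  have \<beta>q: "decseq (\<lambda>k. \<beta> (q k))" "(\<lambda>k. \<beta> (q k)) \<longlonglongrightarrow> 0"
    using \<beta>dec q LIMSEQ_subseq_LIMSEQ[OF \<beta>lim q]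
    by (auto simp: decseq_def o_def strict_mono_less_eq)
  have zC: "z \<in> horizon_cone C"
    unfolding horizon_cone_def using zl \<beta>q \<beta>pos y
    by (auto intro!: exI[of _ "\<lambda>k. y (q k)"] exI[of _ "\<lambda>k. \<beta> (q k)"])
  have "\<exists>w\<in>D. infdist (A *v y n) D = dist (A *v y n) w" for n
    using infdist_attains_inf[OF assms(1,2)] by metis
  then obtain \<eta> where \<eta>: "\<And>n. \<eta> n \<in> D" "\<And>n. infdist (A *v y n) D = dist (A *v y n) (\<eta> n)"
    by metis
  have "(\<lambda>k. \<beta> (q k) *\<^sub>R (\<eta> (q k) - A *v y (q k))) \<longlonglongrightarrow> 0"
  proof (rule Lim_null_comparison)
    show "\<forall>\<^sub>F k in sequentially. norm (\<beta> (q k) *\<^sub>R (\<eta> (q k) - A *v y (q k))) \<le> \<beta> (q k) * r"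
      using y \<eta>(2) \<beta>pos by (auto simp: dist_norm norm_minus_commute less_imp_le)
    show "(\<lambda>k. \<beta> (q k) * r) \<longlonglongrightarrow> 0" using \<beta>q(2) by (rule tendsto_mult_left_zero)
  qed
  moreover have "(\<lambda>k. A *v (\<beta> (q k) *\<^sub>R y (q k))) \<longlonglongrightarrow> A *v z"
    using zl by (intro bounded_linear.tendsto[of "(*v) A"]) auto
  ultimately have "(\<lambda>k. \<beta> (q k) *\<^sub>R (\<eta> (q k) - A *v y (q k)) + A *v (\<beta> (q k) *\<^sub>R y (q k)))
      \<longlonglongrightarrow> 0 + A *v z" by (rule tendsto_add)
  then have "(\<lambda>k. \<beta> (q k) *\<^sub>R \<eta> (q k)) \<longlonglongrightarrow> A *v z"
    by (simp add: algebra_simps matrix_vector_mult_scaleR)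
  then have "A *v z \<in> horizon_cone D"
    unfolding horizon_cone_def using \<beta>q \<beta>pos \<eta>
    by (auto intro!: exI[of _ "\<lambda>k. \<eta> (q k)"] exI[of _ "\<lambda>k. \<beta> (q k)"])
  then have "z = 0" using zC hor by auto
  then show False using z by simp
qed

section \<open>Convergence of the algorithm\<close>

theorem theorem2:
  fixes A :: "real^'n^'m" and C :: "(real^'n) set" and D :: "(real^'m) set"
    and Lmin Lmax \<tau> c :: real and x :: "nat \<Rightarrow> real^'n"
  assumes "closed C" and "C \<noteq> {}" and "closed D" and "D \<noteq> {}"
    and "horizon_cone C \<inter> {z. A *v z \<in> horizon_cone D} = {0}"
    and "KL_function (feas_objective A C D)"
    and "0 < Lmin" and "Lmin \<le> Lmax" and "\<tau> > 1" and "c > 0"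
    and "SpFeas_sequence A C D Lmin Lmax \<tau> c 0 x"
  shows "bounded (range x) \<and>
    (\<forall>xstar. seq_accumulation_point x xstar \<longrightarrow>
       C1_lipschitz_gradient_at (\<lambda>y. 1/2 * (infdist y D)\<^sup>2) (A *v xstar) \<longrightarrow>
       convergent x)"
proof -
  define B where "B = max Lmax (\<tau> * ((onorm ((*v) A))\<^sup>2 + c))"
  have B: "B > 0" using assms(7,8) by (simp add: B_def)
  define F where "F = feas_objective A C D"
  define h where "h t = 1/2 * (infdist (A *v x t) D)\<^sup>2" for t
  have ls: "\<exists>L0\<in>{Lmin..Lmax}. \<exists>L'. line_search A C D \<tau> c 0 x t L0 L' (x (Suc t))" for t
    using assms(11) unfolding SpFeas_sequence_def by blast
  have step: "x t \<in> C \<Longrightarrow> \<exists>L. ls_trial A C D (x t) L (x (Suc t)) \<and>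
      ls_test A D c 0 x t (x (Suc t)) \<and> 0 < L \<and> L \<le> B" for t
    using ls[of t] line_search_bounded[of A C D \<tau> c x t _ _ "x (Suc t)" B] assms(7,9)
    unfolding B_def by fastforce
  have xC: "x t \<in> C" for t
  proof (induction t)
    case 0 show ?case using assms(11) by (simp add: SpFeas_sequence_def)
  next
    case (Suc t)
    then show ?case using step[of t] unfolding ls_trial_def by (blast intro: Proj_mem)
  qed
  obtain L where L: "\<And>t. ls_trial A C D (x t) (L t) (x (Suc t))"
      "\<And>t. ls_test A D c 0 x t (x (Suc t))" "\<And>t. 0 < L t" "\<And>t. L t \<le> B"
    using step[OF xC] by metis
  have dec: "h (Suc t) + c / 2 * (norm (x (Suc t) - x t))\<^sup>2 \<le> h t" for t
    using L(2)[of t] unfolding ls_test_monotone_iff h_def by simp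
  have "h (Suc t) \<le> h t" for t
    using dec[of t] assms(10) by (smt (verit) divide_pos_pos mult_nonneg_nonneg zero_le_power2)
  then have hdec: "decseq h" by (rule decseq_SucI)
  have "infdist (A *v x t) D \<le> infdist (A *v x 0) D" for t
    using decseqD[OF hdec, of 0 t] by (auto simp: h_def intro!: power2_le_imp_le infdist_nonneg)
  then have "range x \<subseteq> {z \<in> C. infdist (A *v z) D \<le> infdist (A *v x 0) D}" using xC by auto
  then have "bounded (range x)"
    using bounded_sublevel_of_horizon_condition[OF assms(3,4), of C A] assms(5) bounded_subset
    by blast
  moreover have "convergent x"
    if acc: "seq_accumulation_point x xs"
      and C1: "C1_lipschitz_gradient_at (\<lambda>y. 1/2 * (infdist y D)\<^sup>2) (A *v xs)" for xs
  proof -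
    obtain g V K where V: "open V" "A *v xs \<in> V"
      and gr: "\<And>y. y \<in> V \<Longrightarrow> GDERIV (\<lambda>y. 1/2 * (infdist y D)\<^sup>2) y :> g y"
      and lip: "K-lipschitz_on V g"
      using C1 unfolding C1_lipschitz_gradient_at_def by blast
    have "open ((*v) A -` V)"
      by (intro open_vimage V) (simp add: linear_continuous_on)
    then obtain \<rho> where \<rho>: "\<rho> > 0" "ball xs \<rho> \<subseteq> (*v) A -` V"
      using V(2) by (metis openE vimageI)
    have inV: "A *v z \<in> V" if "dist z xs < \<rho>" for z
      using \<rho>(2) that by (auto simp: dist_commute)
    define v where "v t = transpose A *v (g (A *v x (Suc t)) - g (A *v x t))
       - L t *\<^sub>R (x (Suc t) - x t)" for t
    define b where "b = onorm ((*v) (transpose A)) * (K * onorm ((*v) A)) + B"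
    have K: "K \<ge> 0" using lip by (rule lipschitz_on_nonneg)
    have on: "onorm ((*v) A) \<ge> 0" "onorm ((*v) (transpose A)) \<ge> 0"
      by (auto intro!: onorm_pos_le)
    have b: "b > 0" unfolding b_def using K B on by (intro add_nonneg_pos) auto
    have vreg: "v t \<in> regular_subdiff F (x (Suc t)) \<and> norm (v t) \<le> b * norm (x (Suc t) - x t)"
      if "dist (x t) xs < \<rho>" "dist (x (Suc t)) xs < \<rho>" for t
    proof
      show "v t \<in> regular_subdiff F (x (Suc t))"
        unfolding v_def F_def using that L by (intro step_regular_subgradient gr inV)
      let ?d = "norm (x (Suc t) - x t)"
      have "norm (g (A *v x (Suc t)) - g (A *v x t)) \<le> K * norm (A *v x (Suc t) - A *v x t)"
        using lipschitz_onD[OF lip] inV that by (simp add: dist_norm)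
      also have "\<dots> \<le> K * (onorm ((*v) A) * ?d)"
        using norm_matrix_le[of A "x (Suc t) - x t"] K
        by (simp add: matrix_vector_mult_diff_distrib mult_left_mono)
      finally have "norm (g (A *v x (Suc t)) - g (A *v x t)) \<le> K * (onorm ((*v) A) * ?d)" .
      then have "norm (transpose A *v (g (A *v x (Suc t)) - g (A *v x t)))
          \<le> onorm ((*v) (transpose A)) * (K * (onorm ((*v) A) * ?d))"
        by (rule order_trans[OF norm_matrix_le mult_left_mono[OF _ on(2)]])
      moreover have "norm (L t *\<^sub>R (x (Suc t) - x t)) \<le> B * ?d"
        using L(3,4)[of t] by (simp add: mult_right_mono)
      ultimately show "norm (v t) \<le> b * ?d"
        unfolding v_def b_def
        using norm_triangle_ineq4[of "transpose A *v (g (A *v x (Suc t)) - g (A *v x t))"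
            "L t *\<^sub>R (x (Suc t) - x t)"] by (simp add: algebra_simps)
    qed
    obtain q where q: "strict_mono q" and xq: "(x \<circ> q) \<longlonglongrightarrow> xs"
      using acc unfolding seq_accumulation_point_def by blast
    define hs where "hs = 1/2 * (infdist (A *v xs) D)\<^sup>2"
    have hcont: "(\<lambda>k. 1/2 * (infdist (A *v X k) D)\<^sup>2) \<longlonglongrightarrow> hs" if "X \<longlonglongrightarrow> xs" for X
      unfolding hs_def using that
      by (intro tendsto_intros bounded_linear.tendsto[of "(*v) A"]) auto
    have "\<forall>t. 0 \<le> h t" by (simp add: h_def)
    then obtain l where l: "h \<longlonglongrightarrow> l" using decseq_convergent[OF hdec] by blast
    have "l = hs"
      using LIMSEQ_subseq_LIMSEQ[OF l q] hcont[OF xq] LIMSEQ_unique by (auto simp: h_def o_def)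
    then have hlim: "h \<longlonglongrightarrow> hs" using l by simp
    have xsC: "xs \<in> C" using closed_sequentially[OF assms(1) _ xq] xC by simp
    have FC: "F z = ereal (1/2 * (infdist (A *v z) D)\<^sup>2)" if "z \<in> C" for z
      using that by (simp add: F_def feas_objective_def indicator_fun_def)
    have dlim: "(\<lambda>t. x (Suc t) - x t) \<longlonglongrightarrow> 0"
      using steps_vanish_of_sufficient_decrease[OF hlim _ dec] assms(10) by simp
    \<comment> \<open>The function is only assumed to have the KL property where its subdifferential is nonempty.
      The iterates right after those of a subsequence with limit xs also converge to xs, and their
      subgradients v are bounded by vanishing steps.\<close>
    have "0 \<in> subdiff F xs"
    proof (rule subdiff_limit_of_regular[where X = "\<lambda>k. x (Suc (q k))" and V = "\<lambda>k. v (q k)"])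
      have dq: "(\<lambda>k. x (Suc (q k)) - x (q k)) \<longlonglongrightarrow> 0"
        using LIMSEQ_subseq_LIMSEQ[OF dlim q] by (simp add: o_def)
      have xq': "(\<lambda>k. x (q k)) \<longlonglongrightarrow> xs" using xq by (simp add: o_def)
      show xSq: "(\<lambda>k. x (Suc (q k))) \<longlonglongrightarrow> xs" using tendsto_add[OF dq xq'] by simp
      show "(\<lambda>k. F (x (Suc (q k)))) \<longlonglongrightarrow> F xs"
        using hcont[OF xSq] unfolding FC[OF xC] FC[OF xsC] hs_def by simp
      have ev: "\<forall>\<^sub>F k in sequentially. v (q k) \<in> regular_subdiff F (x (Suc (q k))) \<and>
          norm (v (q k)) \<le> b * norm (x (Suc (q k)) - x (q k))"
        using tendstoD[OF xq' \<rho>(1)] tendstoD[OF xSq \<rho>(1)] by eventually_elim (rule vreg)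
      then show "\<forall>\<^sub>F k in sequentially. v (q k) \<in> regular_subdiff F (x (Suc (q k)))"
        by eventually_elim simp
      show "(\<lambda>k. v (q k)) \<longlonglongrightarrow> 0"
      proof (rule Lim_null_comparison)
        show "\<forall>\<^sub>F k in sequentially. norm (v (q k)) \<le> b * norm (x (Suc (q k)) - x (q k))"
          using ev by eventually_elim simp
        show "(\<lambda>k. b * norm (x (Suc (q k)) - x (q k))) \<longlonglongrightarrow> 0"
          using dq by (intro tendsto_mult_right_zero tendsto_norm_zero)
      qed
      show "F xs < \<infinity>" using FC[OF xsC] by simp
    qed
    then have KL: "KL_property_at F xs"
      using assms(6) unfolding KL_function_def F_def by blast
    show "convergent x"
    proof (rule KL_descent_convergent[OF KL acc _ _ hlim _ dec b \<rho>(1)])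
      show "F (x t) = ereal (h t)" for t using FC[OF xC] by (simp add: h_def)
      show "F xs = ereal hs" using FC[OF xsC] by (simp add: hs_def)
      show "c / 2 > 0" using assms(10) by simp
      show "\<exists>w\<in>subdiff F (x (Suc t)). norm w \<le> b * norm (x (Suc t) - x t)"
        if "dist (x t) xs < \<rho>" "dist (x (Suc t)) xs < \<rho>" for t
        using vreg[OF that] regular_subdiff_imp_subdiff by blast
    qed
  qed
  ultimately show ?thesis by blast
qed

end
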